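(* Let $(X,\mathcal{B})$ be a design in which every $2$-subset of $X$ is contained in exactly one block, and let $G$ be its incidence graph with vertex bipartition $X \cup \mathcal{B}$; assume $G$ is connected. Then for all $u,u' \in X$ with $u \ne u'$ and $v \in \mathcal{B}$ such that $N(u) \cap N(u') = \{v\}$, $|N(u)| \ge 2$ and $|N(u')| \ge 2$, we have $$\zeta(G) \le |N(u)| + |N(u')| + |N(v)| - 3.$$
   Context: A design $(X,\mathcal{B})$ consists of a finite set $X$ of points and a collection $\mathcal{B}$ of blocks, each a subset of $X$. Its incidence graph is the bipartite graph with vertex set $X \cup \mathcal{B}$ in which $x \in X$ is adjacent to $B \in \mathcal{B}$ iff $x \in B$; $N(\cdot)$ denotes neighbourhood in this graph. Localization game on a finite connected graph $G$ with $k$ cops: the robber chooses a starting vertex, invisible to the cops. In each round the cops first choose any $k$ vertices (not restricted by adjacency), and each cop learns the distance from its vertex to the robber's current vertex. The cops win if after finitely many rounds they determine the robber's vertex uniquely from the probe information; otherwise the robber moves to a neighbouring vertex or stays, and a new round begins. The robber knows the cops' strategy in advance. The localization number $\zeta(G)$ is the least $k$ such that $k$ cops can guarantee capture. *)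

theory Defs
  imports "Graph_Theory.Graph_Theory"
begin

section \<open>Designs and their incidence graphs\<close>

definition design :: "'a set \<Rightarrow> 'a set set \<Rightarrow> bool" where
  "design X \<B> \<longleftrightarrow> finite X \<and> (\<forall>b\<in>\<B>. b \<subseteq> X)"

text \<open>
  The vertex set is the disjoint union of points and blocks: \<open>Inl x\<close> is the point \<open>x\<close> and \<open>Inr b\<close>
  the block \<open>b\<close>. As usual in this library, an undirected edge is a pair of opposite arcs.
\<close>

definition incidence_graph ::
    "'a set \<Rightarrow> 'a set set \<Rightarrow> ('a + 'a set, ('a + 'a set) \<times> ('a + 'a set)) pre_digraph" where
  "incidence_graph X \<B> = with_proj
     \<lparr> pverts = Inl ` X \<union> Inr ` \<B>,
       parcs = {(Inl x, Inr b) | x b. x \<in> X \<and> b \<in> \<B> \<and> x \<in> b}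
             \<union> {(Inr b, Inl x) | x b. x \<in> X \<and> b \<in> \<B> \<and> x \<in> b} \<rparr>"

lemma graph_incidence_graph:
  assumes "design X \<B>"
  shows "graph (incidence_graph X \<B>)"
proof -
  define P :: "('a + 'a set) pair_pre_digraph" where
    "P = \<lparr> pverts = Inl ` X \<union> Inr ` \<B>,
       parcs = {(Inl x, Inr b) | x b. x \<in> X \<and> b \<in> \<B> \<and> x \<in> b}
             \<union> {(Inr b, Inl x) | x b. x \<in> X \<and> b \<in> \<B> \<and> x \<in> b} \<rparr>"
  have "finite X" "\<B> \<subseteq> Pow X"
    using assms by (auto simp: design_def)
  then have fv: "finite (pverts P)"
    by (auto simp: P_def intro: finite_subset)
  have sub: "parcs P \<subseteq> pverts P \<times> pverts P"
    by (auto simp: P_def)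
  have "pair_graph P"
  proof
    show "finite (parcs P)"
      using fv sub by (meson finite_SigmaI finite_subset)
    show "symmetric (with_proj P)"
      by (auto simp: symmetric_def sym_def P_def)
  qed (use fv sub in \<open>auto simp: P_def\<close>)
  then show ?thesis
    unfolding incidence_graph_def P_def by (rule pair_graph.pair_graphD_graph)
qed

definition neighbourhood :: "('v, 'e) pre_digraph \<Rightarrow> 'v \<Rightarrow> 'v set" where
  "neighbourhood G u = {w. u \<rightarrow>\<^bsub>G\<^esub> w}"

definition graph_dist :: "('v, 'e) pre_digraph \<Rightarrow> 'v \<Rightarrow> 'v \<Rightarrow> ereal" where
  "graph_dist G u w = wf_digraph.\<mu> G (\<lambda>_. 1) u w"


section \<open>The localization game\<close>

text \<open>The robber's vertex in round \<open>n\<close> is \<open>r n\<close>.\<close>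

definition robber_walk :: "('v, 'e) pre_digraph \<Rightarrow> (nat \<Rightarrow> 'v) \<Rightarrow> bool" where
  "robber_walk G r \<longleftrightarrow> r 0 \<in> verts G \<and> (\<forall>n. r (Suc n) = r n \<or> r n \<rightarrow>\<^bsub>G\<^esub> r (Suc n))"

text \<open>
  A strategy maps the answers of all previous rounds (one list of distances per round) to the
  vertices probed next. Probes need not be distinct.
\<close>

definition cop_strategy ::
    "('v, 'e) pre_digraph \<Rightarrow> nat \<Rightarrow> (ereal list list \<Rightarrow> 'v list) \<Rightarrow> bool" where
  "cop_strategy G k \<sigma> \<longleftrightarrow> (\<forall>h. length (\<sigma> h) = k \<and> set (\<sigma> h) \<subseteq> verts G)"

text \<open>The answers obtained in the first \<open>n\<close> rounds, that is, in rounds \<open>0, \<dots>, n - 1\<close>.\<close>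

primrec probe_history ::
    "('v, 'e) pre_digraph \<Rightarrow> (ereal list list \<Rightarrow> 'v list) \<Rightarrow> (nat \<Rightarrow> 'v) \<Rightarrow> nat \<Rightarrow> ereal list list" where
  "probe_history G \<sigma> r 0 = []"
| "probe_history G \<sigma> r (Suc n) =
     probe_history G \<sigma> r n @ [map (\<lambda>c. graph_dist G c (r n)) (\<sigma> (probe_history G \<sigma> r n))]"

text \<open>
  After the probes of round \<open>n\<close> the robber's vertex is determined: every walk of the robber that
  explains all answers so far is at the same vertex in round \<open>n\<close>.
\<close>

definition located ::
    "('v, 'e) pre_digraph \<Rightarrow> (ereal list list \<Rightarrow> 'v list) \<Rightarrow> (nat \<Rightarrow> 'v) \<Rightarrow> nat \<Rightarrow> bool" where
  "located G \<sigma> r n \<longleftrightarrow>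
     (\<forall>r'. robber_walk G r' \<and> probe_history G \<sigma> r' (Suc n) = probe_history G \<sigma> r (Suc n)
        \<longrightarrow> r' n = r n)"

text \<open>The robber knows the strategy in advance, so it has to succeed against every walk.\<close>

definition cops_win :: "('v, 'e) pre_digraph \<Rightarrow> nat \<Rightarrow> bool" where
  "cops_win G k \<longleftrightarrow>
     (\<exists>\<sigma>. cop_strategy G k \<sigma> \<and> (\<forall>r. robber_walk G r \<longrightarrow> (\<exists>n. located G \<sigma> r n)))"

definition localization_number :: "('v, 'e) pre_digraph \<Rightarrow> nat" where
  "localization_number G = (LEAST k. cops_win G k)"

end

theory Submission
  imports Defs
begin

text \<open>
  Probe all blocks through \<open>u\<close> or \<open>u'\<close> other than \<open>v\<close>, and all points of \<open>v\<close> other than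
  \<open>u\<close> and \<open>u'\<close>. A point off \<open>v\<close> is the only common point of its joins with \<open>u\<close> and \<open>u'\<close>, so
  these probes, which use all cops but one, recognise a robber standing on any point. A robber who
  never stands on a point can never leave the block where it started, since blocks are pairwise
  non-adjacent; the last cop finds it by running through all blocks, one per round.
\<close>

section \<open>Distances and lengths of walks\<close>

lemma (in wf_digraph) awalk_cost_const_1: "awalk_cost (\<lambda>_. 1) p = real (length p)"
  by (induction p) auto

text \<open>The distance is an infimum over walks, so a strict upper bound on it is already met by
  some walk. Small distances can thus be read off from short walks without showing that the infimum
  is attained.\<close>

lemma graph_dist_less_imp_awalk:
  assumes "wf_digraph G" and "graph_dist G u w < ereal c"
  obtains p where "pre_digraph.awalk G u p w" and "real (length p) < c"
proof -
  interpret wf_digraph G by fact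
  from assms(2) show thesis
    unfolding graph_dist_def \<mu>_def INF_less_iff using that by (auto simp: awalk_cost_const_1)
qed

lemma graph_dist_le_awalk_length:
  assumes "wf_digraph G" and "pre_digraph.awalk G u p w"
  shows "graph_dist G u w \<le> ereal (real (length p))"
proof -
  interpret wf_digraph G by fact
  show ?thesis
    using min_cost_le_walk_cost[OF assms(2), of "\<lambda>_. 1"] by (simp add: graph_dist_def awalk_cost_const_1)
qed

lemma graph_dist_nonneg:
  assumes "wf_digraph G"
  shows "0 \<le> graph_dist G u w"
proof (rule ccontr)
  assume "\<not> 0 \<le> graph_dist G u w"
  then have "graph_dist G u w < ereal 0"
    by (simp add: zero_ereal_def)
  then show False
    by (rule graph_dist_less_imp_awalk[OF assms]) simp
qed

lemma graph_dist_eq_0_iff: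
  assumes "wf_digraph G" and "u \<in> verts G"
  shows "graph_dist G u w = 0 \<longleftrightarrow> u = w"
proof
  interpret wf_digraph G by fact
  assume "graph_dist G u w = 0"
  then have "graph_dist G u w < ereal 1"
    by simp
  then obtain p where "awalk u p w" and "real (length p) < 1"
    by (rule graph_dist_less_imp_awalk[OF assms(1)])
  then show "u = w"
    by (auto simp: awalk_Nil_iff)
next
  interpret wf_digraph G by fact
  assume "u = w"
  then have "awalk u [] w"
    using assms by (simp add: awalk_Nil_iff)
  from graph_dist_le_awalk_length[OF assms(1) this] show "graph_dist G u w = 0"
    using graph_dist_nonneg[OF assms(1)] by (simp add: antisym zero_ereal_def)
qed

text \<open>A distance below 2 is met by a walk with at most one arc. Conversely an arc is a walk of
  length 1, and a shorter walk would be empty and force \<open>u = w\<close>. The condition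
  \<open>u \<noteq> w\<close> excludes loops, whose ends are at distance 0.\<close>

lemma graph_dist_eq_1_iff:
  assumes "wf_digraph G" and "u \<in> verts G"
  shows "graph_dist G u w = 1 \<longleftrightarrow> u \<noteq> w \<and> u \<rightarrow>\<^bsub>G\<^esub> w"
proof
  interpret wf_digraph G by fact
  assume 1: "graph_dist G u w = 1"
  then have "u \<noteq> w"
    using graph_dist_eq_0_iff[OF assms, of w] by auto
  from 1 have "graph_dist G u w < ereal 2"
    by simp
  then obtain p where p: "awalk u p w" "real (length p) < 2"
    by (rule graph_dist_less_imp_awalk[OF assms(1)])
  with \<open>u \<noteq> w\<close> obtain e where "p = [e]"
    by (cases p; cases "tl p") (auto simp: awalk_Nil_iff)
  with p have "u \<rightarrow>\<^bsub>G\<^esub> w"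
    by (auto simp: awalk_simps intro: in_arcs_imp_in_arcs_ends)
  with \<open>u \<noteq> w\<close> show "u \<noteq> w \<and> u \<rightarrow>\<^bsub>G\<^esub> w" ..
next
  interpret wf_digraph G by fact
  assume *: "u \<noteq> w \<and> u \<rightarrow>\<^bsub>G\<^esub> w"
  then obtain e where "e \<in> arcs G" "tail G e = u" "head G e = w"
    by auto
  then have "awalk u [e] w"
    using arc_implies_awalk by blast
  from graph_dist_le_awalk_length[OF assms(1) this] have "graph_dist G u w \<le> 1"
    by (simp add: one_ereal_def)
  moreover have "\<not> graph_dist G u w < 1"
  proof
    assume "graph_dist G u w < 1"
    then have "graph_dist G u w < ereal 1"
      by (simp add: one_ereal_def)
    then obtain p where "awalk u p w" and "real (length p) < 1"
      by (rule graph_dist_less_imp_awalk[OF assms(1)])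
    with * show False
      by (auto simp: awalk_Nil_iff)
  qed
  ultimately show "graph_dist G u w = 1"
    by simp
qed

section \<open>Adjacency in the incidence graph\<close>

lemma verts_incidence_graph: "verts (incidence_graph X \<B>) = Inl ` X \<union> Inr ` \<B>"
  by (simp add: incidence_graph_def)

lemma incidence_graph_adj_iff:
  "p \<rightarrow>\<^bsub>incidence_graph X \<B>\<^esub> q \<longleftrightarrow>
     (\<exists>x\<in>X. \<exists>b\<in>\<B>. x \<in> b \<and> (p = Inl x \<and> q = Inr b \<or> p = Inr b \<and> q = Inl x))"
  by (auto simp: incidence_graph_def with_proj_simps)

lemma neighbourhood_point:
  assumes "x \<in> X"
  shows "neighbourhood (incidence_graph X \<B>) (Inl x) = Inr ` {b \<in> \<B>. x \<in> b}"
  using assms by (auto simp: neighbourhood_def incidence_graph_adj_iff)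

lemma neighbourhood_block:
  assumes "b \<in> \<B>" and "b \<subseteq> X"
  shows "neighbourhood (incidence_graph X \<B>) (Inr b) = Inl ` b"
  using assms by (auto simp: neighbourhood_def incidence_graph_adj_iff)

section \<open>Walks of the robber and how it is located\<close>

lemma robber_walk_in_verts:
  assumes "wf_digraph G" and "robber_walk G r"
  shows "r n \<in> verts G"
proof (induction n)
  case (Suc n)
  then show ?case
    using assms wf_digraph.adj_in_verts(2)[OF assms(1)]
    by (auto simp: robber_walk_def) metis
qed (use assms in \<open>simp add: robber_walk_def\<close>)

lemma robber_walk_blocks_const:
  assumes "robber_walk (incidence_graph X \<B>) r" and "\<And>n x. r n \<noteq> Inl x"
  shows "r n = r 0"
proof (induction n)
  case (Suc n)
  have "r (Suc n) = r n \<or> r n \<rightarrow>\<^bsub>incidence_graph X \<B>\<^esub> r (Suc n)"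
    using assms(1) by (simp add: robber_walk_def)
  then have "r (Suc n) = r n"
    using assms(2) by (auto simp: incidence_graph_adj_iff)
  with Suc show ?case
    by simp
qed simp

lemma length_probe_history [simp]: "length (probe_history G \<sigma> r n) = n"
  by (induction n) auto

text \<open>Walks with equal histories have received the same probes in round \<open>n\<close>,
  since these depend on the earlier answers alone. It therefore suffices that the answers of this
  single round separate \<open>r n\<close> from all other vertices.\<close>

lemma locatedI:
  assumes "wf_digraph G"
    and "\<And>q. q \<in> verts G \<Longrightarrow>
      \<forall>c\<in>set (\<sigma> (probe_history G \<sigma> r n)). graph_dist G c q = graph_dist G c (r n) \<Longrightarrow> q = r n"
  shows "located G \<sigma> r n"
  unfolding located_def
proof (intro allI impI, elim conjE)
  fix r'
  assume r': "robber_walk G r'"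
    and "probe_history G \<sigma> r' (Suc n) = probe_history G \<sigma> r (Suc n)"
  then have "\<forall>c\<in>set (\<sigma> (probe_history G \<sigma> r n)). graph_dist G c (r' n) = graph_dist G c (r n)"
    by auto
  then show "r' n = r n"
    using assms(2) robber_walk_in_verts[OF assms(1) r'] by blast
qed

section \<open>Recognising a robber on a point\<close>

text \<open>Only two kinds of answers matter: 0 from a probed point, and whether a probed block
  answers 1, that is, whether it contains the robber's point. For a robber on \<open>u\<close> or
  \<open>u'\<close>, where no cop probes, \<open>L\<close> or \<open>M\<close> is a probed block
  that answers 1 and so forces \<open>q\<close> to be a point.\<close>

lemma point_resolved:
  assumes design: "design X \<B>"
    and join: "\<And>x y. x \<in> X \<Longrightarrow> y \<in> X \<Longrightarrow> x \<noteq> y \<Longrightarrow> \<exists>b\<in>\<B>. x \<in> b \<and> y \<in> b"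
    and uniq: "\<And>x y b b'. b \<in> \<B> \<Longrightarrow> b' \<in> \<B> \<Longrightarrow> x \<noteq> y \<Longrightarrow> x \<in> b \<Longrightarrow> y \<in> b \<Longrightarrow> x \<in> b' \<Longrightarrow> y \<in> b'
      \<Longrightarrow> b = b'"
    and u: "u \<in> X" "u' \<in> X" "u \<noteq> u'" and v: "v \<in> \<B>" "u \<in> v" "u' \<in> v"
    and L: "L \<in> \<B>" "u \<in> L" "L \<noteq> v" and M: "M \<in> \<B>" "u' \<in> M" "M \<noteq> v"
    and x: "x \<in> X" and q: "q \<in> verts (incidence_graph X \<B>)"
    and same: "\<And>c. c \<in> Inr ` {b \<in> \<B>. (u \<in> b \<or> u' \<in> b) \<and> b \<noteq> v} \<union> Inl ` (v - {u, u'}) \<Longrightarrow>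
      graph_dist (incidence_graph X \<B>) c q = graph_dist (incidence_graph X \<B>) c (Inl x)"
  shows "q = Inl x"
proof -
  let ?G = "incidence_graph X \<B>"
  interpret graph ?G
    by (rule graph_incidence_graph[OF design])
  have wf: "wf_digraph ?G" ..
  show ?thesis
  proof (cases "x \<in> v - {u, u'}")
    case True
    have xv: "Inl x \<in> verts ?G"
      using x by (simp add: verts_incidence_graph)
    have "graph_dist ?G (Inl x) q = graph_dist ?G (Inl x) (Inl x)"
      by (rule same) (use True in blast)
    also have "\<dots> = 0"
      by (simp add: graph_dist_eq_0_iff[OF wf xv])
    finally show ?thesis
      by (simp add: graph_dist_eq_0_iff[OF wf xv])
  next
    case False
    \<comment> \<open>The probe on \<open>b\<close> answers 1 for \<open>x\<close>, hence also for
      \<open>q\<close>, and every neighbour of a block is a point in it.\<close>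
    have adj: "\<exists>y. q = Inl y \<and> y \<in> b" if "b \<in> \<B>" "u \<in> b \<or> u' \<in> b" "b \<noteq> v" "x \<in> b" for b
    proof -
      have b: "Inr b \<in> verts ?G"
        using that by (simp add: verts_incidence_graph)
      have "graph_dist ?G (Inr b) (Inl x) = 1"
        using that x graph_dist_eq_1_iff[OF wf b] by (auto simp: incidence_graph_adj_iff)
      then have "graph_dist ?G (Inr b) q = 1"
        using same[of "Inr b"] that by simp
      then show ?thesis
        using graph_dist_eq_1_iff[OF wf b] by (auto simp: incidence_graph_adj_iff)
    qed
    \<comment> \<open>Conversely, a point of \<open>b\<close> would make the probe on
      \<open>b\<close> answer 1, which it does not do for \<open>x\<close> outside
      \<open>b\<close>.\<close>
    have far: "y \<notin> b" if "q = Inl y" "b \<in> \<B>" "u \<in> b \<or> u' \<in> b" "b \<noteq> v" "x \<notin> b" for b y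
    proof
      assume "y \<in> b"
      have b: "Inr b \<in> verts ?G" and "y \<in> X"
        using that q by (auto simp: verts_incidence_graph)
      then have "graph_dist ?G (Inr b) q = 1"
        using that \<open>y \<in> b\<close> graph_dist_eq_1_iff[OF wf b] by (auto simp: incidence_graph_adj_iff)
      then have "graph_dist ?G (Inr b) (Inl x) = 1"
        using same[of "Inr b"] that by simp
      then show False
        using graph_dist_eq_1_iff[OF wf b] that by (auto simp: incidence_graph_adj_iff)
    qed
    \<comment> \<open>Here \<open>w\<close> is whichever of \<open>u\<close> and \<open>u'\<close>
      equals \<open>x\<close>, and \<open>w'\<close> is the other, so that one argument serves both
      cases.\<close>
    have centre: "q = Inl x"
      if z: "x = w" "{w, w'} = {u, u'}" "w \<noteq> w'" and b: "b \<in> \<B>" "w \<in> b" "b \<noteq> v" for w w' b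
    proof -
      have w: "w \<in> v" "w' \<in> v" "w' \<in> X"
        using z u v by (auto simp: doubleton_eq_iff)
      from adj[of b] z b obtain y where y: "q = Inl y" "y \<in> b"
        by (auto simp: doubleton_eq_iff)
      then have "y \<in> X"
        using q by (auto simp: verts_incidence_graph)
      \<comment> \<open>If \<open>y \<noteq> w\<close>, then \<open>y\<close> lies off
        \<open>v\<close>, because \<open>b\<close> and \<open>v\<close> meet only in
        \<open>w\<close>. The block \<open>c\<close> joining \<open>y\<close> to \<open>w'\<close>
        is then a probed block. By \<open>far\<close> it must contain \<open>w\<close>, so it shares
        \<open>w\<close> and \<open>w'\<close> with \<open>v\<close>, a contradiction.\<close>
      have "y = w"
      proof (rule ccontr)
        assume "y \<noteq> w"
        then have "y \<notin> v"
          using uniq[OF b(1) v(1) \<open>y \<noteq> w\<close>] y b w by auto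
        then obtain c where c: "c \<in> \<B>" "y \<in> c" "w' \<in> c"
          using join[OF \<open>y \<in> X\<close> \<open>w' \<in> X\<close>] w by auto
        then have "c \<noteq> v"
          using \<open>y \<notin> v\<close> by auto
        then have "w \<in> c"
          using far[OF y(1) c(1)] c z by (auto simp: doubleton_eq_iff)
        then show False
          using uniq[OF c(1) v(1) \<open>w \<noteq> w'\<close>] c w \<open>c \<noteq> v\<close> by auto
      qed
      with y z show ?thesis
        by simp
    qed
    consider "x = u" | "x = u'" | "x \<notin> v"
      using False by auto
    then show ?thesis
    proof cases
      case 1
      then show ?thesis
        using centre[of u u' L] u L by auto
    next
      case 2
      then show ?thesis
        using centre[of u' u M] u M by auto
    next
      case 3
      then obtain b c where b: "b \<in> \<B>" "x \<in> b" "u \<in> b" and c: "c \<in> \<B>" "x \<in> c" "u' \<in> c"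
        using join[OF x u(1)] join[OF x u(2)] v by auto
      have ne: "b \<noteq> v" "c \<noteq> v"
        using 3 b c by auto
      \<comment> \<open>A block through \<open>x\<close>, \<open>u\<close> and \<open>u'\<close>
        would share two points with \<open>v\<close> and so equal \<open>v\<close>, which misses
        \<open>x\<close>.\<close>
      have "b \<noteq> c"
        using uniq[OF b(1) v(1) u(3)] b c v ne by auto
      obtain y where y: "q = Inl y" "y \<in> b" "y \<in> c"
        using adj[of b] adj[of c] b c ne by auto
      then have "y = x"
        using uniq[of b c x y] b c \<open>b \<noteq> c\<close> by auto
      with y show ?thesis
        by simp
    qed
  qed
qed

section \<open>The strategy and the number of cops\<close>

lemma cops_win_incidence_graph:
  assumes design: "design X \<B>"
    and ex1: "\<forall>P. P \<subseteq> X \<and> card P = 2 \<longrightarrow> (\<exists>!b. b \<in> \<B> \<and> P \<subseteq> b)"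
    and u: "u \<in> X" "u' \<in> X" "u \<noteq> u'" and v: "v \<in> \<B>" "u \<in> v" "u' \<in> v"
    and two: "card {b \<in> \<B>. u \<in> b} \<ge> 2" "card {b \<in> \<B>. u' \<in> b} \<ge> 2"
  shows "cops_win (incidence_graph X \<B>)
    (card {b \<in> \<B>. u \<in> b} + card {b \<in> \<B>. u' \<in> b} + card v - 3)"
proof -
  let ?G = "incidence_graph X \<B>"
  interpret graph ?G
    by (rule graph_incidence_graph[OF design])
  have wf: "wf_digraph ?G" ..
  have finX: "finite X" and sub: "\<B> \<subseteq> Pow X"
    using design by (auto simp: design_def)
  then have finB: "finite \<B>" and finv: "finite v"
    using v by (auto intro: finite_subset)
  have pair: "\<exists>!b. b \<in> \<B> \<and> {x, y} \<subseteq> b" if "x \<in> X" "y \<in> X" "x \<noteq> y" for x y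
    using ex1[rule_format, of "{x, y}"] that by simp
  have join: "\<exists>b\<in>\<B>. x \<in> b \<and> y \<in> b" if "x \<in> X" "y \<in> X" "x \<noteq> y" for x y
    using pair[OF that] by auto
  have uniq: "b = b'"
    if "b \<in> \<B>" "b' \<in> \<B>" "x \<noteq> y" "x \<in> b" "y \<in> b" "x \<in> b'" "y \<in> b'" for x y b b'
  proof -
    have "x \<in> X" "y \<in> X"
      using that sub by auto
    from pair[OF this \<open>x \<noteq> y\<close>] that show ?thesis
      by (elim ex1E) (metis empty_subsetI insert_subset)
  qed

  define R where "R w = {b \<in> \<B>. w \<in> b} - {v}" for w
  have finR: "finite (R w)" for w
    using finB by (simp add: R_def)
  have cardR: "card (R w) = card {b \<in> \<B>. w \<in> b} - 1" if "w \<in> v" for w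
    using v that finB by (simp add: R_def)
  \<comment> \<open>The degree bounds leave a block besides \<open>v\<close> through each of
    \<open>u\<close> and \<open>u'\<close>, as \<open>point_resolved\<close> requires.\<close>
  have "R u \<noteq> {}" "R u' \<noteq> {}"
    using cardR[of u] cardR[of u'] v two by auto
  then obtain L M where L: "L \<in> \<B>" "u \<in> L" "L \<noteq> v" and M: "M \<in> \<B>" "u' \<in> M" "M \<noteq> v"
    by (auto simp: R_def)
  have disj: "R u \<inter> R u' = {}"
    unfolding R_def using uniq[OF _ v(1) u(3)] v(2,3) by blast

  define S :: "('a + 'a set) set" where "S = Inr ` (R u \<union> R u') \<union> Inl ` (v - {u, u'})"
  \<comment> \<open>The definition of \<open>S\<close> suits counting, as its parts are disjoint;
    this form is the one in \<open>point_resolved\<close>.\<close>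
  have S_eq: "S = Inr ` {b \<in> \<B>. (u \<in> b \<or> u' \<in> b) \<and> b \<noteq> v} \<union> Inl ` (v - {u, u'})"
    by (auto simp: S_def R_def)
  have finS: "finite S"
    using finR finv by (simp add: S_def)
  have "card S = card (R u \<union> R u') + card (v - {u, u'})"
    unfolding S_def using finR finv
    by (subst card_Un_disjoint) (auto simp: card_image)
  also have "\<dots> = card (R u) + card (R u') + (card v - 2)"
    using card_Un_disjoint[OF finR finR disj] finv u v
    by (simp add: card_Diff_subset)
  \<comment> \<open>\<open>Suc\<close> accounts for the scanning cop. Both degrees are positive and
    \<open>card v \<ge> 2\<close> because \<open>u\<close> and \<open>u'\<close> lie in
    \<open>v\<close>, so no subtraction is truncated.\<close>
  finally have cardS: "Suc (card S) = card {b \<in> \<B>. u \<in> b} + card {b \<in> \<B>. u' \<in> b} + card v - 3"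
    using two cardR v card_mono[OF finv, of "{u, u'}"] u by simp
  obtain ps where ps: "set ps = S" "length ps = card S"
    using finite_distinct_list[OF finS] distinct_card by metis
  obtain bs where bs: "set bs = \<B>"
    using finite_list[OF finB] by blast
  have sS: "S \<subseteq> verts ?G"
    using v sub by (auto simp: S_def R_def verts_incidence_graph)

  \<comment> \<open>The default \<open>v\<close> keeps the probe a legal vertex once the list is
    exhausted, as a strategy must answer histories of every length.\<close>
  define scan where "scan n = (if n < length bs then bs ! n else v)" for n
  have scan: "scan n \<in> \<B>" for n
    using bs v by (auto simp: scan_def)
  \<comment> \<open>Of the history only its length is used, which is the number of the current
    round, counted from 0 like the positions in \<open>bs\<close>.\<close>
  define \<sigma> :: "ereal list list \<Rightarrow> ('a + 'a set) list" where
    "\<sigma> h = ps @ [Inr (scan (length h))]" for h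
  have "cop_strategy ?G (Suc (card S)) \<sigma>"
    using ps sS scan by (auto simp: cop_strategy_def \<sigma>_def verts_incidence_graph)
  moreover have "\<exists>n. located ?G \<sigma> r n" if r: "robber_walk ?G r" for r
  proof (cases "\<exists>n x. r n = Inl x")
    case True
    then obtain n x where n: "r n = Inl x"
      by blast
    then have "x \<in> X"
      using robber_walk_in_verts[OF wf r, of n] by (auto simp: verts_incidence_graph)
    have "located ?G \<sigma> r n"
    proof (rule locatedI[OF wf])
      fix q
      assume q: "q \<in> verts ?G"
        and "\<forall>c\<in>set (\<sigma> (probe_history ?G \<sigma> r n)). graph_dist ?G c q = graph_dist ?G c (r n)"
      then have same: "graph_dist ?G c q = graph_dist ?G c (Inl x)" if "c \<in> S" for c
        using that ps n by (simp add: \<sigma>_def)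
      show "q = r n"
        unfolding n
        by (rule point_resolved[OF design _ _ u v L M \<open>x \<in> X\<close> q])
          (fact join, fact uniq, fact same[unfolded S_eq])
    qed
    then show ?thesis ..
  next
    case False
    then have const: "r n = r 0" for n
      by (intro robber_walk_blocks_const[OF r]) auto
    have "r 0 \<in> verts ?G"
      by (rule robber_walk_in_verts[OF wf r])
    then obtain b where b: "b \<in> \<B>" "r 0 = Inr b"
      using False by (auto simp: verts_incidence_graph)
    \<comment> \<open>The robber stays on \<open>b\<close> throughout, so it is still there in the
      round whose number is a position of \<open>b\<close> in the scan; the probe then answers
      0.\<close>
    then obtain n where "n < length bs" "bs ! n = b"
      using bs by (auto simp: in_set_conv_nth)
    then have n: "scan n = b"
      by (simp add: scan_def)
    have bv: "Inr b \<in> verts ?G"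
      using b by (simp add: verts_incidence_graph)
    have rn: "r n = Inr b"
      using const[of n] b by simp
    have "located ?G \<sigma> r n"
    proof (rule locatedI[OF wf])
      fix q
      assume "\<forall>c\<in>set (\<sigma> (probe_history ?G \<sigma> r n)). graph_dist ?G c q = graph_dist ?G c (r n)"
      then have "graph_dist ?G (Inr b) q = graph_dist ?G (Inr b) (Inr b)"
        by (simp add: \<sigma>_def n rn)
      also have "\<dots> = 0"
        by (simp add: graph_dist_eq_0_iff[OF wf bv])
      finally show "q = r n"
        by (simp add: graph_dist_eq_0_iff[OF wf bv] rn)
    qed
    then show ?thesis ..
  qed
  ultimately show ?thesis
    unfolding cops_win_def cardS by blast
qed

section \<open>The bound on the localization number\<close>

theorem theorem2p2:
  fixes X :: "'a set" and \<B> :: "'a set set"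
  assumes "design X \<B>"
    and "\<forall>P. P \<subseteq> X \<and> card P = 2 \<longrightarrow> (\<exists>!b. b \<in> \<B> \<and> P \<subseteq> b)"
    and "Digraph_Component.connected (incidence_graph X \<B>)"
  shows "\<forall>u\<in>X. \<forall>u'\<in>X. \<forall>v\<in>\<B>.
    u \<noteq> u' \<and>
    neighbourhood (incidence_graph X \<B>) (Inl u) \<inter> neighbourhood (incidence_graph X \<B>) (Inl u') = {Inr v} \<and>
    card (neighbourhood (incidence_graph X \<B>) (Inl u)) \<ge> 2 \<and>
    card (neighbourhood (incidence_graph X \<B>) (Inl u')) \<ge> 2 \<longrightarrow>
    int (localization_number (incidence_graph X \<B>)) \<le>
      int (card (neighbourhood (incidence_graph X \<B>) (Inl u)))
      + int (card (neighbourhood (incidence_graph X \<B>) (Inl u')))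
      + int (card (neighbourhood (incidence_graph X \<B>) (Inr v))) - 3"
proof (intro ballI impI, elim conjE)
  let ?G = "incidence_graph X \<B>"
  fix u u' v
  assume u: "u \<in> X" "u' \<in> X" "u \<noteq> u'" and v: "v \<in> \<B>"
    and common: "neighbourhood ?G (Inl u) \<inter> neighbourhood ?G (Inl u') = {Inr v}"
    and two: "card (neighbourhood ?G (Inl u)) \<ge> 2" "card (neighbourhood ?G (Inl u')) \<ge> 2"
  have "v \<subseteq> X"
    using assms(1) v by (simp add: design_def)
  have "Inr v \<in> neighbourhood ?G (Inl u) \<inter> neighbourhood ?G (Inl u')"
    using common by simp
  then have uv: "u \<in> v" "u' \<in> v"
    using u by (auto simp: neighbourhood_point)
  have cards: "card (neighbourhood ?G (Inl u)) = card {b \<in> \<B>. u \<in> b}"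
    "card (neighbourhood ?G (Inl u')) = card {b \<in> \<B>. u' \<in> b}"
    "card (neighbourhood ?G (Inr v)) = card v"
    using u v \<open>v \<subseteq> X\<close> by (simp_all add: neighbourhood_point neighbourhood_block card_image)
  have "localization_number ?G \<le> card {b \<in> \<B>. u \<in> b} + card {b \<in> \<B>. u' \<in> b} + card v - 3"
    unfolding localization_number_def
    using cops_win_incidence_graph[OF assms(1,2) u v uv] two
    by (intro Least_le) (simp add: cards)
  \<comment> \<open>The two degrees sum to at least 4, so subtracting 3 gives the same value in the
    natural numbers and in the integers.\<close>
  then show "int (localization_number ?G) \<le> int (card (neighbourhood ?G (Inl u)))
      + int (card (neighbourhood ?G (Inl u'))) + int (card (neighbourhood ?G (Inr v))) - 3"
    using two by (simp add: cards)
qed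

end
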